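(* Let $\mathfrak{A}$ be a Gelfand residuated lattice. The pure filters of $\mathfrak{A}$ are precisely the sets of the form $\bigcap\{D(\mathfrak{m})\mid \mathfrak{m}\in Max(\mathfrak{A})\cap \mathcal{C}\}$, where $\mathcal{C}$ is a closed subset of $Spec_{h}(\mathfrak{A})$.
   Context: A residuated lattice is an algebra $\mathfrak{A}=(A;\vee,\wedge,\odot,\rightarrow,0,1)$ such that $(A;\vee,\wedge,0,1)$ is a bounded lattice, $(A;\odot,1)$ is a commutative monoid, and $x\odot y\le z$ iff $x\le y\rightarrow z$ for all $x,y,z\in A$. A filter of $\mathfrak{A}$ is a non-empty subset $F\subseteq A$ such that $x,y\in F$ implies $x\odot y\in F$, and $x\in F$, $y\in A$ imply $x\vee y\in F$. $F\veebar G$ is the filter generated by $F\cup G$. A filter is proper if it is not $A$; a maximal filter is a maximal element (under inclusion) among proper filters; a prime filter is a proper filter $\mathfrak{p}$ such that $x\vee y\in\mathfrak{p}$ implies $x\in\mathfrak{p}$ or $y\in\mathfrak{p}$. $Spec(\mathfrak{A})$ and $Max(\mathfrak{A})$ are the sets of prime and maximal filters; $Max(\mathfrak{A})\subseteq Spec(\mathfrak{A})$. $\mathfrak{A}$ is Gelfand if every prime filter is contained in a unique maximal filter. $Spec_h(\mathfrak{A})$ is $Spec(\mathfrak{A})$ with the hull-kernel topology, whose closed basis consists of the sets $h(x)=\{\mathfrak{p}\in Spec(\mathfrak{A})\mid x\in\mathfrak{p}\}$, $x\in A$. For a prime filter $\mathfrak{p}$, $D(\mathfrak{p})=\{a\in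 A\mid a\vee x=1 \text{ for some } x\in A\setminus\mathfrak{p}\}$. For a filter $F$, $\sigma(F)$ is the intersection of all prime filters $\mathfrak{q}$ such that $\mathfrak{q}\subseteq\mathfrak{p}$ for some prime filter $\mathfrak{p}\supseteq F$; equivalently $\sigma(F)=\{a\in A\mid F\veebar a^{\perp}=A\}$, where $a^{\perp}=\{x\in A\mid x\vee a=1\}$. $F$ is pure if $\sigma(F)=F$. Empty intersections are taken to be $A$. *)

theory Defs
  imports "HOL-Analysis.Analysis"
begin

text \<open>The lattice bounds are \<^term>\<open>bot\<close> and \<^term>\<open>top\<close>; the unit of the monoid
  is the greatest element. The bounds are allowed to coincide.\<close>

class residuated_lattice = bounded_lattice + comm_monoid_mult +
  fixes residuum :: "'a \<Rightarrow> 'a \<Rightarrow> 'a"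
  assumes one_eq_top: "1 = top"
    and residuation: "x * y \<le> z \<longleftrightarrow> x \<le> residuum y z"

definition is_filter :: "'a::residuated_lattice set \<Rightarrow> bool" where
  "is_filter F \<longleftrightarrow> F \<noteq> {} \<and> (\<forall>x\<in>F. \<forall>y\<in>F. x * y \<in> F) \<and> (\<forall>x\<in>F. \<forall>y. sup x y \<in> F)"

definition proper_filter :: "'a::residuated_lattice set \<Rightarrow> bool" where
  "proper_filter F \<longleftrightarrow> is_filter F \<and> F \<noteq> UNIV"

definition Max_filters :: "'a::residuated_lattice set set" where
  "Max_filters = {M. proper_filter M \<and> (\<forall>F. proper_filter F \<longrightarrow> M \<subseteq> F \<longrightarrow> F = M)}"

definition Spec :: "'a::residuated_lattice set set" where
  "Spec = {P. proper_filter P \<and> (\<forall>x y. sup x y \<in> P \<longrightarrow> x \<in> P \<or> y \<in> P)}"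

definition gelfand :: "'a::residuated_lattice itself \<Rightarrow> bool" where
  "gelfand _ \<longleftrightarrow> (\<forall>P\<in>Spec :: 'a set set. \<exists>!M. M \<in> Max_filters \<and> P \<subseteq> M)"

definition h_set :: "'a::residuated_lattice \<Rightarrow> 'a set set" where
  "h_set x = {P \<in> Spec. x \<in> P}"

text \<open>Closed base \<^term>\<open>h_set x\<close>, i.e. open base \<^term>\<open>Spec - h_set x\<close>;
  see \<open>closedin_Spec_h\<close> below.\<close>

definition Spec_h :: "'a::residuated_lattice set topology" where
  "Spec_h = topology_generated_by (range (\<lambda>x. Spec - h_set x))"

definition D_filter :: "'a::residuated_lattice set \<Rightarrow> 'a set" where
  "D_filter P = {a. \<exists>x. x \<notin> P \<and> sup a x = 1}"

text \<open>As \<^term>\<open>\<Inter>{} = UNIV\<close>, empty intersections are the whole algebra.\<close>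

definition sigma_filter :: "'a::residuated_lattice set \<Rightarrow> 'a set" where
  "sigma_filter F = \<Inter>{Q \<in> Spec. \<exists>P\<in>Spec. Q \<subseteq> P \<and> F \<subseteq> P}"

definition pure_filter :: "'a::residuated_lattice set \<Rightarrow> bool" where
  "pure_filter F \<longleftrightarrow> is_filter F \<and> sigma_filter F = F"

lemma filter_upward:
  assumes "is_filter F" "x \<in> F" "x \<le> y"
  shows "y \<in> F"
  using assms unfolding is_filter_def by (metis sup.absorb2)

lemma bot_notin_Spec:
  assumes "P \<in> Spec"
  shows "bot \<notin> P"
  using assms filter_upward[of P bot] unfolding Spec_def proper_filter_def by auto

lemma h_set_bot: "h_set bot = {}"
  using bot_notin_Spec by (auto simp: h_set_def)

lemma h_set_sup: "h_set (sup x y) = h_set x \<union> h_set y"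
proof -
  have "sup x y \<in> P \<longleftrightarrow> x \<in> P \<or> y \<in> P" if "P \<in> Spec" for P
    using that filter_upward[of P x "sup x y"] filter_upward[of P y "sup x y"]
    unfolding Spec_def proper_filter_def by auto
  then show ?thesis
    by (auto simp: h_set_def)
qed

lemma topspace_Spec_h: "topspace Spec_h = Spec"
  unfolding Spec_h_def topology_generated_by_topspace using h_set_bot by fastforce

lemma openin_Spec_h:
  "openin Spec_h U \<longleftrightarrow> (\<exists>X. U = (\<Union>x\<in>X. Spec - h_set x))"
proof
  assume "openin Spec_h U"
  then have "generate_topology_on (range (\<lambda>x. Spec - h_set x)) U"
    by (simp add: Spec_h_def openin_topology_generated_by_iff)
  then show "\<exists>X. U = (\<Union>x\<in>X. Spec - h_set x)"
  proof induction
    case Empty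
    show ?case by (rule exI[of _ "{}"]) simp
  next
    case (Int a b)
    then obtain X Y where XY: "a = (\<Union>x\<in>X. Spec - h_set x)" "b = (\<Union>x\<in>Y. Spec - h_set x)"
      by blast
    have "a \<inter> b = (\<Union>z\<in>(\<lambda>(x, y). sup x y) ` (X \<times> Y). Spec - h_set z)"
      unfolding XY by (auto simp: h_set_sup)
    then show ?case by blast
  next
    case (UN K)
    then obtain g where g: "\<And>k. k \<in> K \<Longrightarrow> k = (\<Union>x\<in>g k. Spec - h_set x)"
      by metis
    have "\<Union>K = (\<Union>k\<in>K. \<Union>x\<in>g k. Spec - h_set x)"
      using g by auto
    also have "\<dots> = (\<Union>x\<in>(\<Union>k\<in>K. g k). Spec - h_set x)"
      by blast
    finally show ?case by blast
  next
    case (Basis s)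
    then obtain x where "s = Spec - h_set x" by blast
    then show ?case by (intro exI[of _ "{x}"]) simp
  qed
next
  assume "\<exists>X. U = (\<Union>x\<in>X. Spec - h_set x)"
  then obtain X where X: "U = (\<Union>x\<in>X. Spec - h_set x)" by blast
  have "openin Spec_h (Spec - h_set x)" for x :: 'a
    unfolding Spec_h_def by (rule topology_generated_by_Basis) blast
  then show "openin Spec_h U"
    unfolding X by (intro openin_Union) blast
qed

lemma closedin_Spec_h:
  "closedin Spec_h C \<longleftrightarrow> (\<exists>X. C = Spec \<inter> (\<Inter>x\<in>X. h_set x))"
proof
  assume "closedin Spec_h C"
  then obtain X where "C \<subseteq> Spec" "Spec - C = (\<Union>x\<in>X. Spec - h_set x)"
    unfolding closedin_def topspace_Spec_h openin_Spec_h by blast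
  then have "C = Spec \<inter> (\<Inter>x\<in>X. h_set x)" by blast
  then show "\<exists>X. C = Spec \<inter> (\<Inter>x\<in>X. h_set x)" by blast
next
  assume "\<exists>X. C = Spec \<inter> (\<Inter>x\<in>X. h_set x)"
  then obtain X where X: "C = Spec \<inter> (\<Inter>x\<in>X. h_set x)" by blast
  then have "Spec - C = (\<Union>x\<in>X. Spec - h_set x)" by blast
  then show "closedin Spec_h C"
    unfolding closedin_def topspace_Spec_h openin_Spec_h using X by blast
qed

end

theory Submission
  imports Defs
begin

text \<open>
  The proof rests on two identities and one separation property. By the prime filter theorem,
  \<open>D_filter P\<close> is the intersection of the prime filters below \<open>P\<close> (\<open>D_filter_eq_Inter\<close>). It is
  therefore antitone in \<open>P\<close>, and since every prime filter lies below a maximal one,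
  \<open>sigma_filter F\<close> is the intersection of the \<open>D_filter M\<close> over the maximal \<open>M \<supseteq> F\<close>
  (\<open>sigma_filter_eq_Inter_D_filter\<close>). So a pure filter \<open>F\<close> has the required form, with
  the hull of \<open>F\<close> as closed set.

  Conversely, let \<open>F\<close> be the intersection of the \<open>D_filter M\<close> over the maximal filters \<open>M\<close>
  in a closed set \<open>C\<close>, the hull of some \<open>X\<close>. The same identity for \<open>sigma_filter F\<close> shows that \<open>F\<close>
  is pure once the maximal filters above \<open>F\<close> are exactly those above \<open>X\<close>. This is where the
  Gelfand property enters: if a maximal \<open>N\<close> omits some \<open>x \<in> X\<close>, then some \<open>a \<notin> N\<close> belongs to
  \<open>D_filter M\<close> for every maximal \<open>M\<close> containing \<open>x\<close> (\<open>gelfand_separation\<close>), so \<open>a\<close> lies in \<open>F\<close>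
  and \<open>N\<close> does not contain \<open>F\<close>.
\<close>

section \<open>Multiplication and joins\<close>

lemma le_one: "(x::'a::residuated_lattice) \<le> 1"
  by (simp add: one_eq_top)

lemma mult_right_mono_rl:
  fixes x y z :: "'a::residuated_lattice"
  assumes "x \<le> y"
  shows "x * z \<le> y * z"
  by (meson assms order.trans residuation order.refl)

lemma mult_mono_rl:
  fixes x y z w :: "'a::residuated_lattice"
  assumes "x \<le> y" "z \<le> w"
  shows "x * z \<le> y * w"
  by (metis assms mult.commute mult_right_mono_rl order.trans)

lemma mult_le_left: "(x::'a::residuated_lattice) * y \<le> x"
  using mult_mono_rl[OF order.refl le_one, of x y] by simp

lemma mult_bot: "(x::'a::residuated_lattice) * bot = bot"
  by (metis mult.commute mult_le_left bot.extremum_uniqueI)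

lemma sup_mult_distrib:
  fixes x y z :: "'a::residuated_lattice"
  shows "sup x y * z = sup (x * z) (y * z)"
proof (rule order.antisym)
  have "x \<le> residuum z (sup (x * z) (y * z))" "y \<le> residuum z (sup (x * z) (y * z))"
    by (simp_all flip: residuation)
  then show "sup x y * z \<le> sup (x * z) (y * z)"
    by (simp add: residuation)
qed (simp add: mult_right_mono_rl)

text \<open>By iteration of this inequality, a filter that contains \<open>sup x y\<close> contains \<open>sup (x ^ n) y\<close>,
  although powers may decrease strictly.\<close>

lemma sup_mult_sup_le:
  fixes a b c :: "'a::residuated_lattice"
  shows "sup a c * sup b c \<le> sup (a * b) c"
proof -
  have "sup a c * sup b c = sup (a * sup b c) (c * sup b c)"
    by (rule sup_mult_distrib)
  also have "a * sup b c = sup (a * b) (a * c)"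
    by (metis sup_mult_distrib mult.commute)
  also have "sup (sup (a * b) (a * c)) (c * sup b c) \<le> sup (a * b) c"
    using mult_le_left[of c a] mult_le_left[of c "sup b c"]
    by (simp add: mult.commute le_supI2)
  finally show ?thesis .
qed

section \<open>Filters\<close>

lemma filter_mult: "is_filter F \<Longrightarrow> x \<in> F \<Longrightarrow> y \<in> F \<Longrightarrow> x * y \<in> F"
  by (simp add: is_filter_def)

lemma filter_one: "is_filter F \<Longrightarrow> 1 \<in> F"
  by (metis ex_in_conv filter_upward is_filter_def le_one)

lemma filterI:
  assumes "1 \<in> F" "\<And>x y. x \<in> F \<Longrightarrow> y \<in> F \<Longrightarrow> x * y \<in> F" "\<And>x y. x \<in> F \<Longrightarrow> x \<le> y \<Longrightarrow> y \<in> F"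
  shows "is_filter F"
  unfolding is_filter_def using assms by (metis empty_iff sup_ge1)

lemma filter_power: "is_filter F \<Longrightarrow> x \<in> F \<Longrightarrow> x ^ n \<in> F"
  by (induction n) (auto intro: filter_one filter_mult)

lemma filter_sup_power:
  assumes "is_filter F" "sup x y \<in> F"
  shows "sup (x ^ n) y \<in> F"
proof (induction n)
  case 0
  show ?case
    using filter_upward[OF assms(1) filter_one[OF assms(1)], of "sup 1 y"] by simp
next
  case (Suc n)
  have "sup x y * sup (x ^ n) y \<in> F"
    using assms Suc by (blast intro: filter_mult)
  then show ?case
    using filter_upward[OF assms(1) _ sup_mult_sup_le] by simp
qed

lemma filter_Inter:
  assumes "\<And>F. F \<in> \<F> \<Longrightarrow> is_filter F"
  shows "is_filter (\<Inter>\<F>)"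
proof (rule filterI)
  show "1 \<in> \<Inter>\<F>"
    using assms filter_one by blast
  show "x * y \<in> \<Inter>\<F>" if "x \<in> \<Inter>\<F>" "y \<in> \<Inter>\<F>" for x y
    using that assms filter_mult by blast
  show "y \<in> \<Inter>\<F>" if "x \<in> \<Inter>\<F>" "x \<le> y" for x y
    using that assms filter_upward by blast
qed

lemma filter_Union_chain:
  assumes "\<C> \<noteq> {}" "\<And>F. F \<in> \<C> \<Longrightarrow> is_filter F"
    and "\<And>F G. F \<in> \<C> \<Longrightarrow> G \<in> \<C> \<Longrightarrow> F \<subseteq> G \<or> G \<subseteq> F"
  shows "is_filter (\<Union>\<C>)"
proof (rule filterI)
  show "1 \<in> \<Union>\<C>"
    using assms(1,2) filter_one by blast
  show "x * y \<in> \<Union>\<C>" if xy: "x \<in> \<Union>\<C>" "y \<in> \<Union>\<C>" for x y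
  proof -
    obtain F G where "F \<in> \<C>" "G \<in> \<C>" "x \<in> F" "y \<in> G"
      using xy by blast
    then obtain H where "H \<in> \<C>" "x \<in> H" "y \<in> H"
      using assms(3) by (metis subsetD)
    then show ?thesis
      using assms(2) filter_mult by blast
  qed
  show "y \<in> \<Union>\<C>" if "x \<in> \<Union>\<C>" "x \<le> y" for x y
    using that assms(2) filter_upward by blast
qed

lemma proper_filter_iff_bot: "proper_filter F \<longleftrightarrow> is_filter F \<and> bot \<notin> F"
  unfolding proper_filter_def using filter_upward bot_least by blast

lemma Spec_filter: "P \<in> Spec \<Longrightarrow> is_filter P"
  by (simp add: Spec_def proper_filter_def)

lemma Spec_sup: "P \<in> Spec \<Longrightarrow> sup x y \<in> P \<Longrightarrow> x \<in> P \<or> y \<in> P"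
  by (simp add: Spec_def)

text \<open>For a filter \<open>F\<close> this is the filter generated by \<open>F\<close> and \<open>x\<close>.\<close>

definition adjoin :: "'a::residuated_lattice set \<Rightarrow> 'a \<Rightarrow> 'a set" where
  "adjoin F x = {z. \<exists>q\<in>F. \<exists>n. q * x ^ n \<le> z}"

lemma filter_adjoin:
  assumes "is_filter F"
  shows "is_filter (adjoin F x)"
proof (rule filterI)
  show "1 \<in> adjoin F x"
    unfolding adjoin_def using filter_one[OF assms] le_one by blast
  show "y * z \<in> adjoin F x" if yz: "y \<in> adjoin F x" "z \<in> adjoin F x" for y z
  proof -
    obtain p q m n where *: "p \<in> F" "q \<in> F" "p * x ^ m \<le> y" "q * x ^ n \<le> z"
      using yz unfolding adjoin_def by blast
    then have "(p * q) * x ^ (m + n) \<le> y * z"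
      using mult_mono_rl[OF *(3,4)] by (simp add: power_add mult_ac)
    then show ?thesis
      unfolding adjoin_def using * filter_mult[OF assms] by blast
  qed
  show "z \<in> adjoin F x" if "y \<in> adjoin F x" "y \<le> z" for y z
    using that order.trans unfolding adjoin_def by blast
qed

lemma subset_adjoin: "F \<subseteq> adjoin F x"
  unfolding adjoin_def using mult_le_left by blast

lemma mem_adjoin: "is_filter F \<Longrightarrow> x \<in> adjoin F x"
  unfolding adjoin_def using filter_one
  by (metis (mono_tags, lifting) mem_Collect_eq mult_1 order.refl power_one_right)

section \<open>Prime and maximal filters\<close>

lemma maximal_disjoint_filter_exists:
  assumes "is_filter F" "F \<inter> S = {}"
  obtains Q where "is_filter Q" "Q \<inter> S = {}" "F \<subseteq> Q"
    and "\<And>G. is_filter G \<Longrightarrow> G \<inter> S = {} \<Longrightarrow> Q \<subseteq> G \<Longrightarrow> G = Q"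
proof -
  let ?A = "{G. is_filter G \<and> G \<inter> S = {} \<and> F \<subseteq> G}"
  have "\<exists>Q\<in>?A. \<forall>G\<in>?A. Q \<subseteq> G \<longrightarrow> G = Q"
  proof (rule subset_Zorn_nonempty)
    show "?A \<noteq> {}"
      using assms by blast
    fix \<C>
    assume \<C>: "\<C> \<noteq> {}" "subset.chain ?A \<C>"
    then have "is_filter (\<Union>\<C>)"
      by (intro filter_Union_chain) (auto simp: subset_chain_def)
    then show "\<Union>\<C> \<in> ?A"
      using \<C> by (auto simp: subset_chain_def)
  qed
  then obtain Q where "Q \<in> ?A" "\<forall>G\<in>?A. Q \<subseteq> G \<longrightarrow> G = Q"
    by blast
  then show thesis
    using that[of Q] by (metis (mono_tags, lifting) mem_Collect_eq order.trans)
qed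

text \<open>Were \<open>sup x y\<close> in \<open>Q\<close> but neither \<open>x\<close> nor \<open>y\<close>, the filters generated by \<open>Q\<close> with \<open>x\<close> and
  by \<open>Q\<close> with \<open>y\<close> would both meet \<open>S\<close>. The join of the two meeting points is in \<open>S\<close>, and it is also
  in \<open>Q\<close>, since it lies above \<open>q * sup (x ^ m) (y ^ n)\<close> for some \<open>q \<in> Q\<close>.\<close>

lemma maximal_disjoint_filter_prime:
  assumes Q: "is_filter Q" "Q \<inter> S = {}"
    and max: "\<And>G. is_filter G \<Longrightarrow> G \<inter> S = {} \<Longrightarrow> Q \<subseteq> G \<Longrightarrow> G = Q"
    and S: "S \<noteq> {}" "\<And>s t. s \<in> S \<Longrightarrow> t \<in> S \<Longrightarrow> sup s t \<in> S"
  shows "Q \<in> Spec"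
proof -
  have meets: "\<exists>s\<in>S. \<exists>q\<in>Q. \<exists>n. q * x ^ n \<le> s" if "x \<notin> Q" for x
  proof -
    have "adjoin Q x \<inter> S \<noteq> {}"
      using max[OF filter_adjoin[OF Q(1)] _ subset_adjoin] mem_adjoin[OF Q(1)] that by metis
    then show ?thesis
      unfolding adjoin_def by blast
  qed
  have "x \<in> Q \<or> y \<in> Q" if xy: "sup x y \<in> Q" for x y
  proof (rule ccontr)
    assume "\<not> ?thesis"
    then obtain s t p q m n where *: "s \<in> S" "t \<in> S" "p \<in> Q" "q \<in> Q"
        "p * x ^ m \<le> s" "q * y ^ n \<le> t"
      using meets by metis
    have "sup (x ^ m) (y ^ n) \<in> Q"
      using filter_sup_power[OF Q(1)] xy by (metis sup.commute)
    then have "sup (x ^ m) (y ^ n) * (p * q) \<in> Q"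
      using * filter_mult[OF Q(1)] by blast
    moreover have "sup (x ^ m) (y ^ n) * (p * q) \<le> sup s t"
    proof -
      have "x ^ m * (p * q) \<le> p * x ^ m" "y ^ n * (p * q) \<le> q * y ^ n"
        using mult_le_left[of "p * x ^ m" q] mult_le_left[of "q * y ^ n" p]
        by (simp_all add: mult_ac)
      then show ?thesis
        unfolding sup_mult_distrib using *(5,6) by (meson order.trans sup.mono)
    qed
    ultimately have "sup s t \<in> Q"
      using filter_upward[OF Q(1)] by blast
    then show False
      using S(2) * Q(2) by blast
  qed
  moreover have "Q \<noteq> UNIV"
    using Q(2) S(1) by blast
  ultimately show ?thesis
    using Q(1) by (auto simp: Spec_def proper_filter_def)
qed

text \<open>The prime filter theorem for the least filter \<open>{1}\<close>. The set \<open>S\<close> need not be an ideal,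
  which allows \<open>S\<close> to be given below by explicit joins.\<close>

lemma prime_filter_disjoint:
  assumes "S \<noteq> {}" "\<And>s t. s \<in> S \<Longrightarrow> t \<in> S \<Longrightarrow> sup s t \<in> S" "1 \<notin> S"
  obtains Q where "Q \<in> Spec" "Q \<inter> S = {}"
proof -
  have "is_filter {1::'a}"
    by (rule filterI) (auto intro: order.antisym le_one)
  then obtain Q where "is_filter Q" "Q \<inter> S = {}"
      "\<And>G. is_filter G \<Longrightarrow> G \<inter> S = {} \<Longrightarrow> Q \<subseteq> G \<Longrightarrow> G = Q"
    using maximal_disjoint_filter_exists[of "{1}" S] assms(3) by (metis Int_insert_left_if0 Int_empty_left)
  then show thesis
    using that maximal_disjoint_filter_prime assms(1,2) by metis
qed

lemma Max_filters_subset_Spec: "M \<in> Max_filters \<Longrightarrow> M \<in> Spec"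
  by (rule maximal_disjoint_filter_prime[where S = "{bot}"])
    (auto simp: Max_filters_def proper_filter_iff_bot)

lemma Max_filter_above:
  assumes "proper_filter F"
  obtains M where "M \<in> Max_filters" "F \<subseteq> M"
proof -
  obtain M where "is_filter M" "M \<inter> {bot} = {}" "F \<subseteq> M"
      "\<And>G. is_filter G \<Longrightarrow> G \<inter> {bot} = {} \<Longrightarrow> M \<subseteq> G \<Longrightarrow> G = M"
    using maximal_disjoint_filter_exists[of F "{bot}"] assms unfolding proper_filter_iff_bot by auto
  then show thesis
    using that[of M] by (simp add: Max_filters_def proper_filter_iff_bot)
qed

section \<open>The filters D and the operator sigma\<close>

text \<open>If \<open>a\<close> is not in \<open>D_filter P\<close>, then no join \<open>sup a x\<close> with \<open>x \<notin> P\<close> is \<open>1\<close>. These joins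
  are closed under \<open>sup\<close>, so a prime filter misses all of them; it then misses \<open>a\<close> and everything
  outside \<open>P\<close>.\<close>

lemma D_filter_eq_Inter:
  assumes P: "P \<in> Spec"
  shows "D_filter P = \<Inter>{Q \<in> Spec. Q \<subseteq> P}"
proof (intro equalityI subsetI)
  fix a
  assume "a \<in> D_filter P"
  then obtain x where x: "x \<notin> P" "sup a x = 1"
    unfolding D_filter_def by blast
  have "a \<in> Q" if "Q \<in> Spec" "Q \<subseteq> P" for Q
    using Spec_sup[OF that(1), of a x] filter_one[OF Spec_filter[OF that(1)]] x that(2) by auto
  then show "a \<in> \<Inter>{Q \<in> Spec. Q \<subseteq> P}"
    by blast
next
  fix a
  assume a: "a \<in> \<Inter>{Q \<in> Spec. Q \<subseteq> P}"
  show "a \<in> D_filter P"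
  proof (rule ccontr)
    assume nD: "a \<notin> D_filter P"
    let ?S = "{sup a x |x. x \<notin> P}"
    have bot: "bot \<notin> P"
      using P by (rule bot_notin_Spec)
    have "?S \<noteq> {}"
      using bot by blast
    moreover have "sup s t \<in> ?S" if st: "s \<in> ?S" "t \<in> ?S" for s t
    proof -
      obtain x y where xy: "s = sup a x" "t = sup a y" "x \<notin> P" "y \<notin> P"
        using st by blast
      then have "sup s t = sup a (sup x y)"
        by (simp add: ac_simps)
      moreover have "sup x y \<notin> P"
        using Spec_sup[OF P] xy by blast
      ultimately show ?thesis
        by blast
    qed
    moreover have "1 \<notin> ?S"
      using nD unfolding D_filter_def by force
    ultimately obtain Q where Q: "Q \<in> Spec" "Q \<inter> ?S = {}"
      by (rule prime_filter_disjoint)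
    have notin: "sup a x \<notin> Q" if "x \<notin> P" for x
      using Q(2) that by blast
    have "a \<notin> Q"
      using notin[OF bot] by simp
    moreover have "Q \<subseteq> P"
      using notin filter_upward[OF Spec_filter[OF Q(1)]] by (meson subsetI sup_ge2)
    ultimately show False
      using a Q(1) by blast
  qed
qed

lemma filter_D_filter: "P \<in> Spec \<Longrightarrow> is_filter (D_filter P)"
  unfolding D_filter_eq_Inter by (rule filter_Inter) (simp add: Spec_filter)

lemma D_filter_subset: "P \<in> Spec \<Longrightarrow> D_filter P \<subseteq> P"
  by (auto simp: D_filter_eq_Inter)

text \<open>In \<open>sigma_filter F\<close>, the prime filters below a prime filter \<open>P \<supseteq> F\<close> are among those below
  any maximal filter that contains \<open>P\<close>, so it suffices to let \<open>P\<close> range over maximal filters.\<close>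

lemma sigma_filter_eq_Inter_D_filter:
  "sigma_filter F = \<Inter>{D_filter M | M. M \<in> Max_filters \<and> F \<subseteq> M}"
proof -
  have "(\<exists>P\<in>Spec. Q \<subseteq> P \<and> F \<subseteq> P) \<longleftrightarrow> (\<exists>M\<in>Max_filters. Q \<subseteq> M \<and> F \<subseteq> M)" for Q
  proof
    assume "\<exists>P\<in>Spec. Q \<subseteq> P \<and> F \<subseteq> P"
    then obtain P where P: "P \<in> Spec" "Q \<subseteq> P" "F \<subseteq> P"
      by blast
    then obtain M where "M \<in> Max_filters" "P \<subseteq> M"
      using Max_filter_above[of P] by (auto simp: Spec_def)
    then show "\<exists>M\<in>Max_filters. Q \<subseteq> M \<and> F \<subseteq> M"
      using P by blast
  qed (use Max_filters_subset_Spec in blast)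
  then have "sigma_filter F = \<Inter>{Q \<in> Spec. \<exists>M\<in>Max_filters. Q \<subseteq> M \<and> F \<subseteq> M}"
    unfolding sigma_filter_def by simp
  also have "\<dots> = \<Inter>{\<Inter>{Q \<in> Spec. Q \<subseteq> M} | M. M \<in> Max_filters \<and> F \<subseteq> M}"
    by blast
  also have "\<dots> = \<Inter>{D_filter M | M. M \<in> Max_filters \<and> F \<subseteq> M}"
    by (intro arg_cong[where f = Inter] Collect_cong)
      (metis D_filter_eq_Inter Max_filters_subset_Spec)
  finally show ?thesis .
qed

section \<open>Separation in Gelfand residuated lattices\<close>

text \<open>It is enough to find \<open>y\<close> and \<open>a \<notin> N\<close> with \<open>sup y a = 1\<close> such that \<open>y\<close> annihilates a power of
  \<open>x\<close>: a prime filter containing \<open>x\<close> omits such a \<open>y\<close>, so \<open>y\<close> witnesses \<open>a \<in> D_filter M\<close>. If there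
  were no such pair, some prime filter \<open>P\<close> would miss all the joins \<open>sup y a\<close>. With \<open>y = bot\<close> this
  gives \<open>P \<subseteq> N\<close>; with \<open>a = bot\<close> it says that nothing in \<open>P\<close> annihilates a power of \<open>x\<close>, so \<open>P\<close> and
  \<open>x\<close> together generate a proper filter. A maximal filter above the latter contains \<open>P\<close>, so by
  the Gelfand property it is \<open>N\<close>, which does not contain \<open>x\<close>.\<close>

lemma gelfand_separation:
  fixes x :: "'a::residuated_lattice"
  assumes gelfand: "gelfand TYPE('a)"
    and N: "N \<in> Max_filters" "x \<notin> N"
  obtains a where "a \<notin> N" "\<And>M. M \<in> Spec \<Longrightarrow> x \<in> M \<Longrightarrow> a \<in> D_filter M"
proof -
  have NS: "N \<in> Spec"
    using N(1) by (rule Max_filters_subset_Spec)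
  let ?S = "{sup y a | y a. (\<exists>n. y * x ^ n = bot) \<and> a \<notin> N}"
  have bot_ann: "\<exists>n. bot * x ^ n = bot"
    using mult_bot mult.commute by metis
  have "1 \<in> ?S"
  proof (rule ccontr)
    assume one: "1 \<notin> ?S"
    have "?S \<noteq> {}"
      using bot_ann N(2) by blast
    moreover have "sup s t \<in> ?S" if st: "s \<in> ?S" "t \<in> ?S" for s t
    proof -
      obtain y a m z b n where *: "s = sup y a" "y * x ^ m = bot" "a \<notin> N"
          "t = sup z b" "z * x ^ n = bot" "b \<notin> N"
        using st by blast
      have "sup y z * x ^ (m + n) = sup ((y * x ^ m) * x ^ n) ((z * x ^ n) * x ^ m)"
        by (simp add: sup_mult_distrib power_add mult_ac)
      also have "\<dots> = bot"
        using * mult_bot by (metis mult.commute sup.idem)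
      finally have "sup y z * x ^ (m + n) = bot" .
      moreover have "sup a b \<notin> N"
        using Spec_sup[OF NS] * by blast
      moreover have "sup s t = sup (sup y z) (sup a b)"
        using * by (simp add: ac_simps)
      ultimately show ?thesis
        by blast
    qed
    ultimately obtain P where P: "P \<in> Spec" "P \<inter> ?S = {}"
      using one by (rule prime_filter_disjoint)
    have "sup bot a \<in> ?S" if "a \<notin> N" for a
      using that bot_ann by blast
    then have "P \<subseteq> N"
      using P(2) by auto
    have "bot \<notin> adjoin P x"
    proof
      assume "bot \<in> adjoin P x"
      then obtain q n where q: "q \<in> P" "q * x ^ n = bot"
        unfolding adjoin_def using bot.extremum_uniqueI by blast
      then have "sup q bot \<in> ?S"
        using bot_notin_Spec[OF NS] by blast
      then show False
        using P(2) q(1) by auto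
    qed
    then have "proper_filter (adjoin P x)"
      by (simp add: proper_filter_iff_bot filter_adjoin Spec_filter P(1))
    then obtain M where M: "M \<in> Max_filters" "adjoin P x \<subseteq> M"
      by (rule Max_filter_above)
    then have "P \<subseteq> M" "x \<in> M"
      using subset_adjoin mem_adjoin[OF Spec_filter[OF P(1)]] by blast+
    then have "M = N"
      using gelfand P(1) M(1) N(1) \<open>P \<subseteq> N\<close> unfolding gelfand_def by blast
    then show False
      using \<open>x \<in> M\<close> N(2) by blast
  qed
  then obtain y a n where *: "sup y a = 1" "y * x ^ n = bot" "a \<notin> N"
    by force
  have "a \<in> D_filter M" if M: "M \<in> Spec" "x \<in> M" for M
  proof -
    have "y \<notin> M"
      using filter_mult[OF Spec_filter[OF M(1)] _ filter_power[OF Spec_filter[OF M(1)] M(2)], of y n]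
        *(2) bot_notin_Spec[OF M(1)] by auto
    then show ?thesis
      unfolding D_filter_def using *(1) by (auto simp: sup.commute)
  qed
  then show thesis
    using that *(3) by blast
qed

section \<open>Pure filters\<close>

lemma closedin_Spec_h_hull: "closedin Spec_h C \<longleftrightarrow> (\<exists>X. C = {P \<in> Spec. X \<subseteq> P})"
proof -
  have "Spec \<inter> (\<Inter>x\<in>X. h_set x) = {P \<in> Spec. X \<subseteq> P}" for X :: "'a set"
    by (auto simp: h_set_def)
  then show ?thesis
    by (simp add: closedin_Spec_h)
qed

theorem theorem4p14:
  assumes "gelfand TYPE('a::residuated_lattice)"
  shows "{F :: 'a set. pure_filter F} =
    {\<Inter> {D_filter M | M. M \<in> Max_filters \<inter> C} | C. closedin Spec_h C}"
proof -
  define K :: "'a set \<Rightarrow> 'a set"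
    where "K X = \<Inter>{D_filter M | M. M \<in> Max_filters \<and> X \<subseteq> M}" for X
  have hull: "\<Inter>{D_filter M | M. M \<in> Max_filters \<inter> {P \<in> Spec. X \<subseteq> P}} = K X" for X :: "'a set"
  proof -
    have "M \<in> Max_filters \<inter> {P \<in> Spec. X \<subseteq> P} \<longleftrightarrow> M \<in> Max_filters \<and> X \<subseteq> M" for M
      using Max_filters_subset_Spec by blast
    then show ?thesis
      unfolding K_def by simp
  qed
  have pure_K: "pure_filter (K X)" for X
  proof -
    have "is_filter (K X)"
      unfolding K_def using filter_D_filter Max_filters_subset_Spec by (intro filter_Inter) blast
    moreover have "K X \<subseteq> N \<longleftrightarrow> X \<subseteq> N" if N: "N \<in> Max_filters" for N
    proof
      assume "X \<subseteq> N"
      then have "K X \<subseteq> D_filter N"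
        unfolding K_def using N by blast
      then show "K X \<subseteq> N"
        using D_filter_subset[OF Max_filters_subset_Spec[OF N]] by blast
    next
      assume F: "K X \<subseteq> N"
      show "X \<subseteq> N"
      proof (rule ccontr)
        assume "\<not> X \<subseteq> N"
        then obtain x where x: "x \<in> X" "x \<notin> N"
          by blast
        obtain a where a: "a \<notin> N" "\<And>M. M \<in> Spec \<Longrightarrow> x \<in> M \<Longrightarrow> a \<in> D_filter M"
          using gelfand_separation[OF assms N x(2)] by blast
        have "a \<in> K X"
          unfolding K_def using a(2) x(1) Max_filters_subset_Spec by blast
        then show False
          using F a(1) by blast
      qed
    qed
    then have "M \<in> Max_filters \<and> K X \<subseteq> M \<longleftrightarrow> M \<in> Max_filters \<and> X \<subseteq> M" for M
      by blast
    then have "sigma_filter (K X) = K X"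
      by (simp add: sigma_filter_eq_Inter_D_filter K_def[of X, symmetric])
    ultimately show ?thesis
      by (simp add: pure_filter_def)
  qed
  show ?thesis
  proof (intro equalityI subsetI)
    fix F :: "'a set"
    assume "F \<in> {F. pure_filter F}"
    then have "F = K F"
      using sigma_filter_eq_Inter_D_filter[of F] by (simp add: pure_filter_def K_def)
    moreover have "closedin Spec_h {P \<in> Spec. F \<subseteq> P}"
      unfolding closedin_Spec_h_hull by (rule exI) (rule refl)
    ultimately show "F \<in> {\<Inter>{D_filter M | M. M \<in> Max_filters \<inter> C} | C. closedin Spec_h C}"
      using hull[of F] by (intro CollectI exI[of _ "{P \<in> Spec. F \<subseteq> P}"]) simp
  next
    fix F :: "'a set"
    assume "F \<in> {\<Inter>{D_filter M | M. M \<in> Max_filters \<inter> C} | C. closedin Spec_h C}"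
    then obtain C where C: "closedin Spec_h C" "F = \<Inter>{D_filter M | M. M \<in> Max_filters \<inter> C}"
      by (elim CollectE exE conjE)
    then obtain X where "C = {P \<in> Spec. X \<subseteq> P}"
      unfolding closedin_Spec_h_hull by (elim exE)
    then have "F = K X"
      using C(2) hull[of X] by simp
    then show "F \<in> {F. pure_filter F}"
      using pure_K by simp
  qed
qed

end
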